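(* Let $\sigma$ be a ring endomorphism of $R$ and $S=R[x;\sigma]$. Let $I$ be a $\sigma$-stable ideal of $R$. Then the following conditions (1), (2), (3) are equivalent. (1) $I$ is right $S$-prime, i.e. $I[x;\sigma]=IS$ is a prime ideal of $S$. (2) If $a,b\in R$, $p\in\mathbb{N}$, and $a\sigma^p(R)\sigma^q(b)\subseteq I$ for all $q\ge p$, then $a\in I$ or $b\in I$. (3) If $A$ is a left ideal of $R$, $B$ is a $\sigma$-stable ideal of $R$, and $A\sigma^p(B)\subseteq I$ for some $p\in\mathbb{N}$, then $A\subseteq I$ or $B\subseteq I$. If $I$ is $\sigma$-invariant, and either $R$ is commutative or $\sigma$ is surjective, then conditions (1), (2), and (3) are all equivalent to: (4) If $A,B$ are ideals of $R$ with $B$ $\sigma$-stable and $AB\subseteq I$, then $A\subseteq I$ or $B\subseteq I$.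
   Context: Rings have $1$, ideals are two-sided unless stated otherwise, $\mathbb{N}$ is the set of nonnegative integers. $R[x;\sigma]$ is the skew polynomial ring with coefficients written on the left and $xr=\sigma(r)x$ for $r\in R$. A subset $X$ of $R$ is $\sigma$-stable if $\sigma(X)\subseteq X$ and $\sigma$-invariant if $\sigma^{-1}(X)=X$. If $I$ is a $\sigma$-stable ideal of $R$, then $IS$ is an ideal of $S$.
   Formalization: The equivalence of (1) with the other conditions is stated only for I different from R: for I = R, conditions (2), (3) and (4) hold trivially, but IS = S is not a proper ideal and so is not prime. *)

theory Defs
  imports "HOL-Algebra.UnivPoly" "HOL-Algebra.Ideal_Product"
begin

text \<open>
  Skew polynomials are finitely supported coefficient sequences with coefficients on the left.
  From \<open>x r = \<sigma>(r) x\<close> one gets \<open>(a x\<^sup>i) (b x\<^sup>j) = a \<sigma>\<^sup>i(b) x\<^sup>i\<^sup>+\<^sup>j\<close>.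
\<close>

definition skew_poly_ring :: "('a, 'm) ring_scheme \<Rightarrow> ('a \<Rightarrow> 'a) \<Rightarrow> (nat \<Rightarrow> 'a) ring" where
  "skew_poly_ring R \<sigma> =
     \<lparr> carrier = up R,
       mult = (\<lambda>f g n. \<Oplus>\<^bsub>R\<^esub>i\<in>{..n}. f i \<otimes>\<^bsub>R\<^esub> (\<sigma> ^^ i) (g (n - i))),
       one = (\<lambda>n. if n = 0 then \<one>\<^bsub>R\<^esub> else \<zero>\<^bsub>R\<^esub>),
       zero = (\<lambda>n. \<zero>\<^bsub>R\<^esub>),
       add = (\<lambda>f g n. f n \<oplus>\<^bsub>R\<^esub> g n) \<rparr>"

definition skew_const :: "('a, 'm) ring_scheme \<Rightarrow> 'a \<Rightarrow> nat \<Rightarrow> 'a" where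
  "skew_const R a = (\<lambda>n. if n = 0 then a else \<zero>\<^bsub>R\<^esub>)"

text \<open>\<open>I[x;\<sigma>]\<close>: only the underlying set of sequences, so \<open>\<sigma>\<close> does not occur.\<close>

definition skew_poly_over :: "('a, 'm) ring_scheme \<Rightarrow> 'a set \<Rightarrow> (nat \<Rightarrow> 'a) set" where
  "skew_poly_over R I = {f \<in> up R. \<forall>n. f n \<in> I}"

text \<open>
  \<open>IS\<close>: \<^const>\<open>ideal_prod\<close> is defined for arbitrary subsets; it consists of the finite nonempty
  sums of products.
\<close>

definition skew_extension :: "('a, 'm) ring_scheme \<Rightarrow> ('a \<Rightarrow> 'a) \<Rightarrow> 'a set \<Rightarrow> (nat \<Rightarrow> 'a) set" where
  "skew_extension R \<sigma> I =
     skew_const R ` I \<cdot>\<^bsub>skew_poly_ring R \<sigma>\<^esub> carrier (skew_poly_ring R \<sigma>)"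

definition left_ideal :: "'a set \<Rightarrow> ('a, 'm) ring_scheme \<Rightarrow> bool" where
  "left_ideal A R \<longleftrightarrow>
     additive_subgroup A R \<and> (\<forall>r\<in>carrier R. \<forall>a\<in>A. r \<otimes>\<^bsub>R\<^esub> a \<in> A)"

text \<open>
  Prime ideals of a not necessarily commutative ring; the locale \<^locale>\<open>primeideal\<close> is
  restricted to commutative rings and uses elements instead of ideals.
\<close>

definition prime_two_sided_ideal :: "'a set \<Rightarrow> ('a, 'm) ring_scheme \<Rightarrow> bool" where
  "prime_two_sided_ideal P R \<longleftrightarrow>
     ideal P R \<and> P \<noteq> carrier R \<and>
     (\<forall>A B. ideal A R \<longrightarrow> ideal B R \<longrightarrow> A \<cdot>\<^bsub>R\<^esub> B \<subseteq> P \<longrightarrow> A \<subseteq> P \<or> B \<subseteq> P)"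

definition sigma_stable :: "('a \<Rightarrow> 'a) \<Rightarrow> 'a set \<Rightarrow> bool" where
  "sigma_stable \<sigma> X \<longleftrightarrow> \<sigma> ` X \<subseteq> X"

definition sigma_invariant :: "('a, 'm) ring_scheme \<Rightarrow> ('a \<Rightarrow> 'a) \<Rightarrow> 'a set \<Rightarrow> bool" where
  "sigma_invariant R \<sigma> X \<longleftrightarrow> {r \<in> carrier R. \<sigma> r \<in> X} = X"

definition right_S_prime :: "('a, 'm) ring_scheme \<Rightarrow> ('a \<Rightarrow> 'a) \<Rightarrow> 'a set \<Rightarrow> bool" where
  "right_S_prime R \<sigma> I \<longleftrightarrow>
     prime_two_sided_ideal (skew_extension R \<sigma> I) (skew_poly_ring R \<sigma>)"

definition elementwise_cond :: "('a, 'm) ring_scheme \<Rightarrow> ('a \<Rightarrow> 'a) \<Rightarrow> 'a set \<Rightarrow> bool" where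
  "elementwise_cond R \<sigma> I \<longleftrightarrow>
     (\<forall>a\<in>carrier R. \<forall>b\<in>carrier R. \<forall>p::nat.
        (\<forall>q\<ge>p. \<forall>r\<in>carrier R. a \<otimes>\<^bsub>R\<^esub> (\<sigma> ^^ p) r \<otimes>\<^bsub>R\<^esub> (\<sigma> ^^ q) b \<in> I) \<longrightarrow> a \<in> I \<or> b \<in> I)"

definition left_ideal_cond :: "('a, 'm) ring_scheme \<Rightarrow> ('a \<Rightarrow> 'a) \<Rightarrow> 'a set \<Rightarrow> bool" where
  "left_ideal_cond R \<sigma> I \<longleftrightarrow>
     (\<forall>A B. left_ideal A R \<longrightarrow> ideal B R \<longrightarrow> sigma_stable \<sigma> B \<longrightarrow>
        (\<exists>p::nat. A \<cdot>\<^bsub>R\<^esub> ((\<sigma> ^^ p) ` B) \<subseteq> I) \<longrightarrow> A \<subseteq> I \<or> B \<subseteq> I)"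

definition stable_ideal_cond :: "('a, 'm) ring_scheme \<Rightarrow> ('a \<Rightarrow> 'a) \<Rightarrow> 'a set \<Rightarrow> bool" where
  "stable_ideal_cond R \<sigma> I \<longleftrightarrow>
     (\<forall>A B. ideal A R \<longrightarrow> ideal B R \<longrightarrow> sigma_stable \<sigma> B \<longrightarrow>
        A \<cdot>\<^bsub>R\<^esub> B \<subseteq> I \<longrightarrow> A \<subseteq> I \<or> B \<subseteq> I)"

end

theory Submission
  imports Defs
begin

text \<open>
  Modulo \<open>IS\<close> every element of \<open>S\<close> outside \<open>IS\<close> has a last coefficient outside \<open>I\<close>, and
  the top coefficients of the products \<open>f (r x\<^sup>k) g\<close> form exactly the family
  \<open>a \<sigma>\<^sup>p(r) \<sigma>\<^sup>q(b)\<close>, \<open>q \<ge> p\<close>, of condition (2), where \<open>a\<close> and \<open>b\<close> are these last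
  coefficients of \<open>f\<close> and \<open>g\<close>, and \<open>p\<close> is the position of \<open>a\<close>; conversely, \<open>f = a x\<^sup>p\<close> and \<open>g = b\<close> recover (2) from primeness.
  The passages to (2) from (3) and to (3) from (4) apply the hypothesis to annihilators modulo \<open>I\<close>
  rather than to generated ideals. In the latter, commutativity of \<open>R\<close> or surjectivity of \<open>\<sigma>\<close> is
  what makes the left annihilator of \<open>\<sigma>\<^sup>p(B)\<close> a right ideal, and invariance of \<open>I\<close> is what
  recovers \<open>B \<subseteq> I\<close> from \<open>\<sigma>\<^sup>p(B) \<subseteq> I\<close>.
\<close>

section \<open>One-sided ideals, sums modulo a subgroup, and primeness tested on elements\<close>

lemma (in ring) left_idealI:
  assumes "A \<subseteq> carrier R" "\<zero> \<in> A"
    and "\<And>x y. x \<in> A \<Longrightarrow> y \<in> A \<Longrightarrow> x \<oplus> y \<in> A"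
    and "\<And>r x. r \<in> carrier R \<Longrightarrow> x \<in> A \<Longrightarrow> r \<otimes> x \<in> A"
  shows "left_ideal A R"
proof -
  have "\<ominus> x \<in> A" if "x \<in> A" for x
  proof -
    have "\<ominus> x = (\<ominus> \<one>) \<otimes> x"
      using that assms(1) by (simp add: l_minus subset_iff)
    then show ?thesis using assms(4)[OF _ that, of "\<ominus> \<one>"] by simp
  qed
  then have "subgroup A (add_monoid R)"
    using assms(1-3) by (intro add.subgroupI) auto
  then show ?thesis
    using assms(4) unfolding left_ideal_def by (auto intro: additive_subgroupI)
qed

lemma left_ideal_imp_ideal:
  assumes "ring R" "left_ideal A R"
    and "\<And>r x. r \<in> carrier R \<Longrightarrow> x \<in> A \<Longrightarrow> x \<otimes>\<^bsub>R\<^esub> r \<in> A"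
  shows "ideal A R"
  using assms
  by (auto intro!: idealI simp: left_ideal_def additive_subgroup_def)

lemma ideal_imp_left_ideal: "ideal A R \<Longrightarrow> left_ideal A R"
  by (simp add: left_ideal_def ideal.axioms(1) ideal.I_l_closed)

lemma ideal_prod_subset_iff:
  assumes "additive_subgroup P R"
  shows "A \<cdot>\<^bsub>R\<^esub> B \<subseteq> P \<longleftrightarrow> (\<forall>a\<in>A. \<forall>b\<in>B. a \<otimes>\<^bsub>R\<^esub> b \<in> P)"
proof
  assume ab: "\<forall>a\<in>A. \<forall>b\<in>B. a \<otimes>\<^bsub>R\<^esub> b \<in> P"
  have "s \<in> P" if "s \<in> A \<cdot>\<^bsub>R\<^esub> B" for s
    using that by induct (use ab assms in \<open>auto intro: additive_subgroup.a_closed\<close>)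
  then show "A \<cdot>\<^bsub>R\<^esub> B \<subseteq> P" by blast
qed (auto intro: ideal_prod.prod)

lemma (in ring) finsum_in_additive_subgroup:
  assumes "additive_subgroup H R" "finite X" "\<And>x. x \<in> X \<Longrightarrow> f x \<in> H"
  shows "finsum R f X \<in> H"
  using assms(2,3)
proof (induct rule: finite_induct)
  case empty
  then show ?case by (simp add: additive_subgroup.zero_closed[OF assms(1)])
next
  case (insert x X)
  have "f \<in> X \<rightarrow> carrier R" "f x \<in> carrier R"
    using insert.prems additive_subgroup.a_subset[OF assms(1)] by auto
  then show ?case
    using insert by (simp add: additive_subgroup.a_closed[OF assms(1)])
qed

text \<open>Modulo \<open>H\<close> every summand except the one at \<open>m\<close> vanishes. This
  later isolates, in a coefficient of a product, the one term built from last coefficients.\<close>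

lemma (in ring) finsum_in_additive_subgroup_iff:
  assumes H: "additive_subgroup H R" and "finite X" "m \<in> X" "f \<in> X \<rightarrow> carrier R"
    and "\<And>x. x \<in> X \<Longrightarrow> x \<noteq> m \<Longrightarrow> f x \<in> H"
  shows "finsum R f X \<in> H \<longleftrightarrow> f m \<in> H"
proof -
  interpret H: additive_subgroup H R by fact
  define t where "t = finsum R f (X - {m})"
  have t: "t \<in> H" unfolding t_def
    using assms by (intro finsum_in_additive_subgroup) auto
  have tc: "t \<in> carrier R" "f m \<in> carrier R" using t H.a_subset assms(3,4) by auto
  have "finsum R f (insert m (X - {m})) = f m \<oplus> t"
    unfolding t_def using assms by (intro finsum_insert) auto
  then have eq: "finsum R f X = f m \<oplus> t" using assms(3) by (simp add: insert_absorb)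
  have "f m = (f m \<oplus> t) \<oplus> \<ominus> t" using tc by (simp add: a_assoc r_neg)
  then show ?thesis
    using eq t H.a_closed H.a_inv_closed by metis
qed

lemma (in ring) finsum_eq_single:
  assumes "finite X" "m \<in> X" "f \<in> X \<rightarrow> carrier R"
    and "\<And>x. x \<in> X \<Longrightarrow> x \<noteq> m \<Longrightarrow> f x = \<zero>"
  shows "finsum R f X = f m"
proof -
  have "finsum R f X = (\<Oplus>x\<in>X. if m = x then f x else \<zero>)"
    using assms by (intro finsum_cong') auto
  also have "\<dots> = f m"
    using assms by (intro finsum_singleton) auto
  finally show ?thesis .
qed

text \<open>
  The ideals used for the forward direction are \<open>A = {x. x R b \<subseteq> P}\<close> and the
  right annihilator \<open>{y. A y \<subseteq> P}\<close> of \<open>A\<close> modulo \<open>P\<close>.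
\<close>

lemma (in ring) prime_two_sided_ideal_iff:
  assumes "ideal P R"
  shows "prime_two_sided_ideal P R \<longleftrightarrow> P \<noteq> carrier R \<and>
    (\<forall>a\<in>carrier R. \<forall>b\<in>carrier R. (\<forall>r\<in>carrier R. a \<otimes> r \<otimes> b \<in> P) \<longrightarrow> a \<in> P \<or> b \<in> P)"
    (is "_ \<longleftrightarrow> _ \<and> ?E")
proof -
  interpret P: ideal P R by fact
  have ?E if prime: "\<And>A B. ideal A R \<Longrightarrow> ideal B R \<Longrightarrow> A \<cdot> B \<subseteq> P \<Longrightarrow> A \<subseteq> P \<or> B \<subseteq> P"
  proof (intro ballI impI)
    fix a b assume ab: "a \<in> carrier R" "b \<in> carrier R" "\<forall>r\<in>carrier R. a \<otimes> r \<otimes> b \<in> P"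
    define A where "A = {x \<in> carrier R. \<forall>r\<in>carrier R. x \<otimes> r \<otimes> b \<in> P}"
    define B where "B = {y \<in> carrier R. \<forall>x\<in>A. x \<otimes> y \<in> P}"
    have A: "ideal A R"
    proof (intro left_ideal_imp_ideal left_idealI ring_axioms)
      fix r x assume "r \<in> carrier R" "x \<in> A"
      then show "r \<otimes> x \<in> A"
        using ab(2) P.I_l_closed[of _ r] by (auto simp: A_def m_assoc)
      \<comment> \<open>The new right factor \<open>r\<close> is absorbed into the middle element,
        which ranges over all of \<open>R\<close>.\<close>
      have "x \<otimes> (r \<otimes> s) \<otimes> b \<in> P" if "s \<in> carrier R" for s
        using \<open>x \<in> A\<close> \<open>r \<in> carrier R\<close> that by (simp add: A_def)
      then show "x \<otimes> r \<in> A"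
        using \<open>x \<in> A\<close> \<open>r \<in> carrier R\<close> by (simp add: A_def m_assoc)
    qed (use ab(2) in \<open>auto simp: A_def l_distr\<close>)
    have B: "ideal B R"
    proof (intro left_ideal_imp_ideal left_idealI ring_axioms)
      fix r y assume r: "r \<in> carrier R" and y: "y \<in> B"
      have "x \<otimes> (r \<otimes> y) \<in> P" if "x \<in> A" for x
      proof -
        \<comment> \<open>Since \<open>A\<close> is also a right ideal, \<open>x \<otimes> r\<close>
          is again an element that \<open>y\<close> must annihilate modulo \<open>P\<close>.\<close>
        have "(x \<otimes> r) \<otimes> y \<in> P" using ideal.I_r_closed[OF A that r] y by (simp add: B_def)
        then show ?thesis using that r y by (simp add: A_def B_def m_assoc)
      qed
      then show "r \<otimes> y \<in> B" using r y by (simp add: B_def)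
      have "x \<otimes> (y \<otimes> r) \<in> P" if "x \<in> A" for x
      proof -
        have "(x \<otimes> y) \<otimes> r \<in> P" using that r y by (simp add: B_def P.I_r_closed)
        then show ?thesis using that r y by (simp add: A_def B_def m_assoc)
      qed
      then show "y \<otimes> r \<in> B" using r y by (simp add: B_def)
    qed (auto simp: A_def B_def r_distr)
    have "A \<cdot> B \<subseteq> P"
      by (subst ideal_prod_subset_iff) (auto simp: B_def P.is_additive_subgroup)
    from prime[OF A B this] have "A \<subseteq> P \<or> B \<subseteq> P" .
    moreover have "a \<in> A" using ab by (simp add: A_def)
    moreover have "b \<in> B"
    proof -
      have "x \<otimes> b \<in> P" if "x \<in> A" for x
      proof -
        have "x \<otimes> \<one> \<otimes> b \<in> P" using that unfolding A_def by blast
        then show ?thesis using that by (simp add: A_def)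
      qed
      then show ?thesis using ab(2) by (simp add: B_def)
    qed
    ultimately show "a \<in> P \<or> b \<in> P" by blast
  qed
  moreover have "A \<subseteq> P \<or> B \<subseteq> P"
    if E: ?E and A: "ideal A R" and B: "ideal B R" and AB: "A \<cdot> B \<subseteq> P" for A B
  proof (rule ccontr)
    assume "\<not> (A \<subseteq> P \<or> B \<subseteq> P)"
    then obtain a b where ab: "a \<in> A" "a \<notin> P" "b \<in> B" "b \<notin> P" by blast
    have "a \<otimes> r \<otimes> b \<in> P" if "r \<in> carrier R" for r
    proof -
      have "a \<otimes> r \<in> A" using ideal.I_r_closed[OF A] ab(1) that by blast
      then show ?thesis using AB ab(3) by (blast intro: ideal_prod.prod)
    qed
    then show False
      using E ab ideal.Icarr[OF A] ideal.Icarr[OF B] by blast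
  qed
  ultimately show ?thesis
    using assms unfolding prime_two_sided_ideal_def by blast
qed

section \<open>The ring structure of \<open>S\<close>\<close>

locale skew_ring = ring R for R (structure) +
  fixes \<sigma> :: "'a \<Rightarrow> 'a"
  assumes sigma_hom: "\<sigma> \<in> ring_hom R R"
begin

abbreviation S :: "(nat \<Rightarrow> 'a) ring" where "S \<equiv> skew_poly_ring R \<sigma>"

lemma sigma_pow_hom: "\<sigma> ^^ n \<in> ring_hom R R"
proof (induct n)
  case 0
  then show ?case by (auto intro: ring_hom_memI)
next
  case (Suc n)
  from ring_hom_trans[OF Suc sigma_hom] show ?case by (simp add: comp_def)
qed

lemma sigma_pow_ring_hom_ring: "ring_hom_ring R R (\<sigma> ^^ n)"
  by (intro ring_hom_ringI2 ring_axioms sigma_pow_hom)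

lemma sigma_pow_closed [simp, intro]: "a \<in> carrier R \<Longrightarrow> (\<sigma> ^^ n) a \<in> carrier R"
  using ring_hom_closed[OF sigma_pow_hom] .

lemma sigma_pow_mult [simp]:
  "a \<in> carrier R \<Longrightarrow> b \<in> carrier R \<Longrightarrow> (\<sigma> ^^ n) (a \<otimes> b) = (\<sigma> ^^ n) a \<otimes> (\<sigma> ^^ n) b"
  using ring_hom_mult[OF sigma_pow_hom] .

lemma sigma_pow_add [simp]:
  "a \<in> carrier R \<Longrightarrow> b \<in> carrier R \<Longrightarrow> (\<sigma> ^^ n) (a \<oplus> b) = (\<sigma> ^^ n) a \<oplus> (\<sigma> ^^ n) b"
  using ring_hom_add[OF sigma_pow_hom] .

lemma sigma_pow_one [simp]: "(\<sigma> ^^ n) \<one> = \<one>"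
  using ring_hom_one[OF sigma_pow_hom] .

lemma sigma_pow_zero [simp]: "(\<sigma> ^^ n) \<zero> = \<zero>"
  using ring_hom_zero[OF sigma_pow_hom] ring_axioms by blast

lemma sigma_pow_sigma_pow [simp]: "(\<sigma> ^^ m) ((\<sigma> ^^ n) a) = (\<sigma> ^^ (m + n)) a"
  by (simp add: funpow_add)

lemma sigma_pow_finsum:
  "f \<in> X \<rightarrow> carrier R \<Longrightarrow> (\<sigma> ^^ n) (finsum R f X) = finsum R ((\<sigma> ^^ n) \<circ> f) X"
  using ring_hom_ring.hom_finsum[OF sigma_pow_ring_hom_ring] .

lemma sigma_pow_stable:
  assumes "sigma_stable \<sigma> X" "a \<in> X"
  shows "(\<sigma> ^^ n) a \<in> X"
  using assms by (induct n) (auto simp: sigma_stable_def)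

lemma skew_carrier [simp]: "carrier S = up R"
  and skew_zero [simp]: "\<zero>\<^bsub>S\<^esub> = (\<lambda>n. \<zero>)"
  and skew_one [simp]: "\<one>\<^bsub>S\<^esub> = (\<lambda>n. if n = 0 then \<one> else \<zero>)"
  and skew_add: "f \<oplus>\<^bsub>S\<^esub> g = (\<lambda>n. f n \<oplus> g n)"
  and skew_mult: "f \<otimes>\<^bsub>S\<^esub> g = (\<lambda>n. \<Oplus>i\<in>{..n}. f i \<otimes> (\<sigma> ^^ i) (g (n - i)))"
  by (simp_all add: skew_poly_ring_def)

lemma up_coeff [simp]: "f \<in> up R \<Longrightarrow> f n \<in> carrier R"
  by (rule mem_upD)

lemma up_bounded:
  assumes "f \<in> up R"
  obtains N where "\<And>n. n > N \<Longrightarrow> f n = \<zero>"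
  using bound_upD[OF assms] that by (auto simp: bound_def)

lemma up_I:
  assumes "\<And>n. f n \<in> carrier R" "\<And>n. n > N \<Longrightarrow> f n = \<zero>"
  shows "f \<in> up R"
  using assms by (intro mem_upI) (auto simp: bound_def)

lemma skew_mult_closed:
  assumes "f \<in> up R" "g \<in> up R"
  shows "f \<otimes>\<^bsub>S\<^esub> g \<in> up R"
proof -
  obtain M where M: "\<And>n. n > M \<Longrightarrow> f n = \<zero>" using up_bounded[OF assms(1)] by blast
  obtain N where N: "\<And>n. n > N \<Longrightarrow> g n = \<zero>" using up_bounded[OF assms(2)] by blast
  show ?thesis
  proof (rule up_I[of _ "M + N"])
    fix n assume n: "n > M + N"
    have "f i \<otimes> (\<sigma> ^^ i) (g (n - i)) = \<zero>" if "i \<in> {..n}" for i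
    proof (cases "i > M")
      case True then show ?thesis using M assms by simp
    next
      case False then show ?thesis using N[of "n - i"] n assms by simp
    qed
    then show "(f \<otimes>\<^bsub>S\<^esub> g) n = \<zero>"
      unfolding skew_mult by (rule add.finprod_one_eqI)
  qed (use assms in \<open>auto simp: skew_mult\<close>)
qed

text \<open>Both sides sum \<open>a j \<otimes> b j i \<otimes> c (j + i)\<close> over all
  \<open>j + i \<le> k\<close>. The factor \<open>b\<close> carries two indices because the middle
  polynomial is twisted by a power of \<open>\<sigma>\<close> that depends on the position in the
  first one.\<close>

lemma finsum_skew_assoc:
  fixes a c :: "nat \<Rightarrow> 'a" and b :: "nat \<Rightarrow> nat \<Rightarrow> 'a"
  assumes [simp]: "\<And>i. a i \<in> carrier R" "\<And>i j. b i j \<in> carrier R" "\<And>i. c i \<in> carrier R"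
  shows "(\<Oplus>j\<in>{..k}. (\<Oplus>i\<in>{..j}. a i \<otimes> b i (j - i)) \<otimes> c j) =
    (\<Oplus>j\<in>{..k}. a j \<otimes> (\<Oplus>i\<in>{..k-j}. b j i \<otimes> c (j + i)))"
proof (induct k)
  case 0
  then show ?case by (simp add: m_assoc)
next
  case (Suc k)
  define t where "t j = (\<Oplus>i\<in>{..k-j}. b j i \<otimes> c (j + i))" for j
  have [simp]: "t j \<in> carrier R" for j unfolding t_def by auto
  \<comment> \<open>For \<open>j \<le> k\<close> the inner sum gains exactly the term
    \<open>i = Suc k - j\<close>, whose last factor is \<open>c (Suc k)\<close>.\<close>
  have "(\<Oplus>j\<in>{..k}. a j \<otimes> (\<Oplus>i\<in>{..Suc k-j}. b j i \<otimes> c (j + i))) =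
    (\<Oplus>j\<in>{..k}. a j \<otimes> b j (Suc k - j) \<otimes> c (Suc k) \<oplus> a j \<otimes> t j)"
    by (intro finsum_cong') (auto simp: Suc_diff_le r_distr t_def m_assoc)
  also have "\<dots> = (\<Oplus>j\<in>{..k}. a j \<otimes> b j (Suc k - j)) \<otimes> c (Suc k) \<oplus> (\<Oplus>j\<in>{..k}. a j \<otimes> t j)"
    by (simp add: finsum_addf finsum_ldistr)
  finally show ?case
    using Suc[folded t_def] by (simp add: l_distr m_assoc a_ac)
qed

lemma skew_mult_assoc:
  assumes f: "f \<in> up R" and g: "g \<in> up R" and h: "h \<in> up R"
  shows "(f \<otimes>\<^bsub>S\<^esub> g) \<otimes>\<^bsub>S\<^esub> h = f \<otimes>\<^bsub>S\<^esub> (g \<otimes>\<^bsub>S\<^esub> h)"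
proof
  fix n
  have "((f \<otimes>\<^bsub>S\<^esub> g) \<otimes>\<^bsub>S\<^esub> h) n =
    (\<Oplus>j\<in>{..n}. f j \<otimes> (\<Oplus>i\<in>{..n-j}. (\<sigma> ^^ j) (g i) \<otimes> (\<sigma> ^^ (j + i)) (h (n - (j + i)))))"
    unfolding skew_mult using f g h
    \<comment> \<open>Here \<open>a\<close> is \<open>f\<close>, \<open>b j i\<close> is
      \<open>\<sigma>^j(g i)\<close>, and \<open>c m\<close> is
      \<open>\<sigma>^m(h (n - m))\<close>.\<close>
    by (subst finsum_skew_assoc[symmetric]) auto
  also have "\<dots> = (f \<otimes>\<^bsub>S\<^esub> (g \<otimes>\<^bsub>S\<^esub> h)) n"
    unfolding skew_mult using f g h
    by (intro finsum_cong') (auto simp: sigma_pow_finsum comp_def)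
  finally show "((f \<otimes>\<^bsub>S\<^esub> g) \<otimes>\<^bsub>S\<^esub> h) n = (f \<otimes>\<^bsub>S\<^esub> (g \<otimes>\<^bsub>S\<^esub> h)) n" .
qed

definition skew_monom :: "'a \<Rightarrow> nat \<Rightarrow> nat \<Rightarrow> 'a" where
  "skew_monom a p = (\<lambda>n. if n = p then a else \<zero>)"

lemma skew_monom_closed [simp, intro]: "a \<in> carrier R \<Longrightarrow> skew_monom a p \<in> up R"
  by (rule up_I[of _ p]) (auto simp: skew_monom_def)

lemma skew_monom_mult:
  assumes "a \<in> carrier R" "f \<in> up R"
  shows "(skew_monom a p \<otimes>\<^bsub>S\<^esub> f) n = (if p \<le> n then a \<otimes> (\<sigma> ^^ p) (f (n - p)) else \<zero>)"
proof (cases "p \<le> n")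
  case True
  have "(skew_monom a p \<otimes>\<^bsub>S\<^esub> f) n = skew_monom a p p \<otimes> (\<sigma> ^^ p) (f (n - p))"
    unfolding skew_mult using assms True
    by (intro finsum_eq_single) (auto simp: skew_monom_def)
  then show ?thesis using True by (simp add: skew_monom_def)
next
  case False
  then show ?thesis unfolding skew_mult using assms
    by (auto simp: skew_monom_def intro!: add.finprod_one_eqI)
qed

text \<open>Moving the constant \<open>a\<close> to the left past \<open>x^n\<close> turns it into
  \<open>\<sigma>^n(a)\<close>.\<close>

lemma mult_skew_monom_0:
  assumes "a \<in> carrier R" "f \<in> up R"
  shows "(f \<otimes>\<^bsub>S\<^esub> skew_monom a 0) n = f n \<otimes> (\<sigma> ^^ n) a"
proof -
  have "(f \<otimes>\<^bsub>S\<^esub> skew_monom a 0) n = f n \<otimes> (\<sigma> ^^ n) (skew_monom a 0 (n - n))"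
    unfolding skew_mult using assms
    by (intro finsum_eq_single) (auto simp: skew_monom_def)
  then show ?thesis by (simp add: skew_monom_def)
qed

lemma skew_const_eq_skew_monom: "skew_const R a = skew_monom a 0"
  by (simp add: skew_const_def skew_monom_def)

lemma skew_one_eq_skew_monom: "\<one>\<^bsub>S\<^esub> = skew_monom \<one> 0"
  by (simp add: skew_monom_def)

lemma ring_skew_poly_ring: "ring S"
proof (intro ringI abelian_groupI monoidI)
  fix f assume "f \<in> carrier S"
  then show "\<exists>g\<in>carrier S. g \<oplus>\<^bsub>S\<^esub> f = \<zero>\<^bsub>S\<^esub>"
    by (intro bexI[of _ "\<lambda>n. \<ominus> f n"]) (auto simp: skew_add l_neg up_a_inv_closed)
next
  fix f assume f: "f \<in> carrier S"
  then show "\<one>\<^bsub>S\<^esub> \<otimes>\<^bsub>S\<^esub> f = f" "f \<otimes>\<^bsub>S\<^esub> \<one>\<^bsub>S\<^esub> = f"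
    unfolding skew_one_eq_skew_monom by (auto simp: fun_eq_iff skew_monom_mult mult_skew_monom_0)
next
  fix f g h assume "f \<in> carrier S" "g \<in> carrier S" "h \<in> carrier S"
  then show "(f \<oplus>\<^bsub>S\<^esub> g) \<otimes>\<^bsub>S\<^esub> h = f \<otimes>\<^bsub>S\<^esub> h \<oplus>\<^bsub>S\<^esub> g \<otimes>\<^bsub>S\<^esub> h"
    "h \<otimes>\<^bsub>S\<^esub> (f \<oplus>\<^bsub>S\<^esub> g) = h \<otimes>\<^bsub>S\<^esub> f \<oplus>\<^bsub>S\<^esub> h \<otimes>\<^bsub>S\<^esub> g"
    by (simp_all add: skew_add skew_mult l_distr r_distr finsum_addf fun_eq_iff)
qed (auto simp: up_one_closed skew_mult_closed skew_mult_assoc up_add_closed skew_add a_ac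
      intro: up_I)

section \<open>The extension of a stable ideal to \<open>S\<close>\<close>

context
  fixes I
  assumes ideal_I: "ideal I R" and stable_I: "sigma_stable \<sigma> I"
begin

interpretation I: ideal I R by (rule ideal_I)

lemma mem_skew_poly_over: "f \<in> skew_poly_over R I \<longleftrightarrow> f \<in> up R \<and> (\<forall>n. f n \<in> I)"
  by (simp add: skew_poly_over_def)

text \<open>In a product with the ideal element on the right, powers of \<open>\<sigma>\<close> hit
  its coefficients, and stability keeps these in \<open>I\<close>. With the ideal element on the
  left, its coefficients are only multiplied from the right.\<close>

lemma skew_poly_over_ideal: "ideal (skew_poly_over R I) S"
proof (intro left_ideal_imp_ideal ring_skew_poly_ring ring.left_idealI[OF ring_skew_poly_ring])
  fix f g assume f: "f \<in> carrier S" and g: "g \<in> skew_poly_over R I"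
  have "f i \<otimes> (\<sigma> ^^ i) (g (n - i)) \<in> I" "g i \<otimes> (\<sigma> ^^ i) (f (n - i)) \<in> I" for i n
    using f g sigma_pow_stable[OF stable_I]
    by (auto simp: mem_skew_poly_over intro: I.I_l_closed I.I_r_closed)
  then show "f \<otimes>\<^bsub>S\<^esub> g \<in> skew_poly_over R I" "g \<otimes>\<^bsub>S\<^esub> f \<in> skew_poly_over R I"
    using f g
    by (auto simp: mem_skew_poly_over skew_mult_closed)
      (auto simp: skew_mult intro!: finsum_in_additive_subgroup[OF I.is_additive_subgroup])
qed (auto simp: mem_skew_poly_over skew_add up_add_closed intro: up_I)

text \<open>Induction on the bound peels off the top term \<open>f N x^N\<close>, a product of a
  constant from \<open>I\<close> and an element of \<open>S\<close>.\<close>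

lemma mem_skew_extension_bounded:
  assumes "\<And>n. f n \<in> I" "\<And>n. n \<ge> N \<Longrightarrow> f n = \<zero>"
  shows "f \<in> skew_extension R \<sigma> I"
  using assms
proof (induct N arbitrary: f)
  case 0
  \<comment> \<open>Sums in \<open>ideal_prod\<close> are nonempty, so zero itself has to be
    exhibited as a product.\<close>
  then have "f = skew_monom \<zero> 0 \<otimes>\<^bsub>S\<^esub> skew_monom \<zero> 0"
    by (simp add: fun_eq_iff skew_monom_mult)
  then show ?case unfolding skew_extension_def
    by (auto simp: skew_const_eq_skew_monom intro!: ideal_prod.prod)
next
  case (Suc N)
  have "f = skew_monom (f N) 0 \<otimes>\<^bsub>S\<^esub> skew_monom \<one> N \<oplus>\<^bsub>S\<^esub> f(N := \<zero>)"
    using Suc.prems(1) by (auto simp: fun_eq_iff skew_add skew_monom_mult) (auto simp: skew_monom_def)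
  moreover have "f(N := \<zero>) \<in> skew_extension R \<sigma> I"
    using Suc.prems by (intro Suc.hyps) (auto simp: Suc_le_eq)
  moreover have "skew_monom (f N) 0 \<otimes>\<^bsub>S\<^esub> skew_monom \<one> N \<in> skew_extension R \<sigma> I"
    unfolding skew_extension_def using Suc.prems(1)
    by (intro ideal_prod.prod) (auto simp: skew_const_eq_skew_monom)
  ultimately show ?case
    unfolding skew_extension_def by (metis ideal_prod.sum)
qed

lemma skew_poly_over_eq_extension: "skew_poly_over R I = skew_extension R \<sigma> I"
proof
  show "skew_poly_over R I \<subseteq> skew_extension R \<sigma> I"
  proof
    fix f assume f: "f \<in> skew_poly_over R I"
    then obtain N where "\<And>n. n > N \<Longrightarrow> f n = \<zero>"
      using up_bounded by (auto simp: mem_skew_poly_over)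
    with f show "f \<in> skew_extension R \<sigma> I"
      by (intro mem_skew_extension_bounded[of _ "Suc N"]) (auto simp: mem_skew_poly_over)
  qed
  show "skew_extension R \<sigma> I \<subseteq> skew_poly_over R I"
    unfolding skew_extension_def
    by (subst ideal_prod_subset_iff)
      (auto simp: ideal.axioms(1) skew_poly_over_ideal skew_const_eq_skew_monom mem_skew_poly_over
        skew_mult_closed skew_monom_mult I.I_r_closed)
qed

section \<open>Primeness of the extension and the elementwise condition\<close>

text \<open>Constants show that the extension is all of \<open>S\<close> only if \<open>I\<close> is
  all of \<open>R\<close>; the rest is the elementwise form of primeness in
  \<open>S\<close>.\<close>

lemma right_S_prime_iff:
  "right_S_prime R \<sigma> I \<longleftrightarrow> I \<noteq> carrier R \<and> (\<forall>f\<in>up R. \<forall>g\<in>up R.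
     (\<forall>h\<in>up R. f \<otimes>\<^bsub>S\<^esub> h \<otimes>\<^bsub>S\<^esub> g \<in> skew_poly_over R I) \<longrightarrow>
       f \<in> skew_poly_over R I \<or> g \<in> skew_poly_over R I)"
proof -
  have "skew_poly_over R I = up R \<longleftrightarrow> I = carrier R"
  proof
    assume eq: "skew_poly_over R I = up R"
    have "a \<in> I" if "a \<in> carrier R" for a
    proof -
      have "skew_monom a 0 \<in> skew_poly_over R I" using that eq by auto
      then have "skew_monom a 0 0 \<in> I" unfolding mem_skew_poly_over by blast
      then show ?thesis by (simp add: skew_monom_def)
    qed
    then show "I = carrier R" using I.a_subset by blast
  qed (use mem_skew_poly_over in auto)
  then show ?thesis
    unfolding right_S_prime_def skew_poly_over_eq_extension[symmetric]
    by (simp add: ring.prime_two_sided_ideal_iff[OF ring_skew_poly_ring skew_poly_over_ideal])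
qed

lemma right_S_prime_imp_elementwise:
  assumes "right_S_prime R \<sigma> I"
  shows "elementwise_cond R \<sigma> I"
  unfolding elementwise_cond_def
proof (intro ballI allI impI)
  fix a b p
  assume a: "a \<in> carrier R" and b: "b \<in> carrier R"
    and ab: "\<forall>q\<ge>p. \<forall>r\<in>carrier R. a \<otimes> (\<sigma> ^^ p) r \<otimes> (\<sigma> ^^ q) b \<in> I"
  \<comment> \<open>The coefficient at \<open>q\<close> is
    \<open>a \<sigma>^p(h (q - p)) \<sigma>^q(b)\<close> for \<open>q \<ge> p\<close> and zero for
    \<open>q < p\<close>.\<close>
  have "skew_monom a p \<otimes>\<^bsub>S\<^esub> h \<otimes>\<^bsub>S\<^esub> skew_monom b 0 \<in> skew_poly_over R I" if h: "h \<in> up R" for h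
    using a b ab h
    by (auto simp: mem_skew_poly_over skew_mult_closed mult_skew_monom_0 skew_monom_mult)
  then have "skew_monom a p \<in> skew_poly_over R I \<or> skew_monom b 0 \<in> skew_poly_over R I"
    using assms a b unfolding right_S_prime_iff by blast
  then have "skew_monom a p p \<in> I \<or> skew_monom b 0 0 \<in> I"
    unfolding mem_skew_poly_over by blast
  then show "a \<in> I \<or> b \<in> I" by (simp add: skew_monom_def)
qed

text \<open>Coefficients outside \<open>I\<close> are nonzero, so their positions are bounded and a
  greatest one exists. The value there acts as a leading coefficient modulo
  \<open>I\<close>.\<close>

lemma last_coeff_notin:
  assumes "f \<in> up R" "f \<notin> skew_poly_over R I"
  obtains m where "f m \<notin> I" "\<And>i. i > m \<Longrightarrow> f i \<in> I"
proof -
  obtain N where N: "\<And>n. n > N \<Longrightarrow> f n = \<zero>" using up_bounded[OF assms(1)] by blast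
  obtain k where k: "f k \<notin> I" using assms by (auto simp: mem_skew_poly_over)
  have bnd: "i \<le> N" if "f i \<notin> I" for i
    using N[of i] that by (cases "i \<le> N") auto
  show ?thesis
  proof (rule that)
    show "f (GREATEST i. f i \<notin> I) \<notin> I"
      using GreatestI_nat[of "\<lambda>i. f i \<notin> I", OF k] bnd by blast
    show "f i \<in> I" if "i > (GREATEST i. f i \<notin> I)" for i
      using Greatest_le_nat[of "\<lambda>i. f i \<notin> I" i N] bnd that by fastforce
  qed
qed

lemma elementwise_imp_right_S_prime:
  assumes proper: "I \<noteq> carrier R" and elt: "elementwise_cond R \<sigma> I"
  shows "right_S_prime R \<sigma> I"
proof -
  have False if f: "f \<in> up R" "f \<notin> skew_poly_over R I" and g: "g \<in> up R" "g \<notin> skew_poly_over R I"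
    and prod: "\<And>h. h \<in> up R \<Longrightarrow> f \<otimes>\<^bsub>S\<^esub> h \<otimes>\<^bsub>S\<^esub> g \<in> skew_poly_over R I" for f g
  proof -
    obtain m where m: "f m \<notin> I" "\<And>i. i > m \<Longrightarrow> f i \<in> I" using last_coeff_notin[OF f] by blast
    obtain n where n: "g n \<notin> I" "\<And>i. i > n \<Longrightarrow> g i \<in> I" using last_coeff_notin[OF g] by blast
    have "f m \<otimes> (\<sigma> ^^ m) r \<otimes> (\<sigma> ^^ q) (g n) \<in> I" if "q \<ge> m" and r: "r \<in> carrier R" for q r
    proof -
      \<comment> \<open>The test element is \<open>r x^k\<close>. With \<open>m + k = q\<close>, the
        coefficient of \<open>f (r x^k) g\<close> at \<open>m + n + k\<close> contains the desired
        product as its summand \<open>t m\<close>.\<close>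
      define k where "k = q - m"
      define t where "t i = f i \<otimes> (\<sigma> ^^ i) ((skew_monom r k \<otimes>\<^bsub>S\<^esub> g) (m + n + k - i))" for i
      have h: "skew_monom r k \<otimes>\<^bsub>S\<^esub> g \<in> up R" using r g(1) by (simp add: skew_mult_closed)
      have "(f \<otimes>\<^bsub>S\<^esub> skew_monom r k \<otimes>\<^bsub>S\<^esub> g) (m + n + k) \<in> I"
        using prod[of "skew_monom r k"] r unfolding mem_skew_poly_over by blast
      then have "finsum R t {..m + n + k} \<in> I"
        using f(1) g(1) r unfolding t_def
        by (simp only: skew_mult_assoc skew_monom_closed) (simp only: skew_mult[of f])
      moreover have "finsum R t {..m + n + k} \<in> I \<longleftrightarrow> t m \<in> I"
      proof (rule finsum_in_additive_subgroup_iff[OF I.is_additive_subgroup])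
        show "t \<in> {..m + n + k} \<rightarrow> carrier R" using f(1) h by (auto simp: t_def)
        fix i assume "i \<in> {..m + n + k}" "i \<noteq> m"
        then consider "i > m" | "i < m" by linarith
        then show "t i \<in> I"
        proof cases
          case 1
          then show ?thesis using m(2) h unfolding t_def by (blast intro: I.I_r_closed up_coeff sigma_pow_closed)
        next
          case 2
          \<comment> \<open>For \<open>i < m\<close> the index equals \<open>m + n - i\<close>,
            which exceeds \<open>n\<close>.\<close>
          then have "g (m + n + k - i - k) \<in> I" by (intro n(2)) auto
          then have "(skew_monom r k \<otimes>\<^bsub>S\<^esub> g) (m + n + k - i) \<in> I"
            using r g(1) sigma_pow_stable[OF stable_I] by (simp add: skew_monom_mult I.I_l_closed)
          then show ?thesis unfolding t_def
            using f(1) sigma_pow_stable[OF stable_I] by (intro I.I_l_closed) auto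
        qed
      qed auto
      ultimately have "t m \<in> I" by blast
      moreover have "q = m + k" "m + n + k - m = n + k" using \<open>q \<ge> m\<close> by (simp_all add: k_def)
      ultimately show ?thesis
        using f(1) g(1) r by (simp add: t_def skew_monom_mult m_assoc)
    qed
    then have "f m \<in> I \<or> g n \<in> I"
      using elt f(1) g(1) unfolding elementwise_cond_def by (meson up_coeff)
    with m n show False by blast
  qed
  then show ?thesis unfolding right_S_prime_iff using proper by blast
qed

section \<open>The elementwise condition and the left ideal condition\<close>

lemma elementwise_imp_left_ideal_cond:
  assumes elt: "elementwise_cond R \<sigma> I"
  shows "left_ideal_cond R \<sigma> I"
  unfolding left_ideal_cond_def
proof (intro allI impI)
  fix A B
  assume A: "left_ideal A R" and B: "ideal B R" "sigma_stable \<sigma> B"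
    and "\<exists>p. A \<cdot> ((\<sigma> ^^ p) ` B) \<subseteq> I"
  then obtain p where p: "\<And>a b. a \<in> A \<Longrightarrow> b \<in> B \<Longrightarrow> a \<otimes> (\<sigma> ^^ p) b \<in> I"
    by (auto simp: ideal_prod_subset_iff I.is_additive_subgroup)
  interpret B: ideal B R by fact
  have sub: "A \<subseteq> carrier R"
    using A by (auto simp: left_ideal_def dest: additive_subgroup.a_subset)
  show "A \<subseteq> I \<or> B \<subseteq> I"
  proof (rule ccontr)
    assume "\<not> (A \<subseteq> I \<or> B \<subseteq> I)"
    then obtain a b where ab: "a \<in> A" "a \<notin> I" "b \<in> B" "b \<notin> I" by blast
    have "a \<otimes> (\<sigma> ^^ p) r \<otimes> (\<sigma> ^^ q) b \<in> I" if "q \<ge> p" and r: "r \<in> carrier R" for q r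
    proof -
      \<comment> \<open>Factoring out \<open>\<sigma>^p\<close> gives \<open>\<sigma>^p(r)
        \<sigma>^q(b) = \<sigma>^p(r \<sigma>^(q-p)(b))\<close>, and the argument lies in
        \<open>B\<close> because \<open>B\<close> is a stable ideal.\<close>
      have "r \<otimes> (\<sigma> ^^ (q - p)) b \<in> B"
        using r ab(3) sigma_pow_stable[OF B(2)] by (intro B.I_l_closed) auto
      from p[OF ab(1) this] show ?thesis
        using ab sub r that by (simp add: m_assoc subset_iff)
    qed
    then show False
      using elt ab sub B.Icarr unfolding elementwise_cond_def by blast
  qed
qed

lemma left_ideal_cond_imp_elementwise:
  assumes cond: "left_ideal_cond R \<sigma> I"
  shows "elementwise_cond R \<sigma> I"
  unfolding elementwise_cond_def
proof (intro ballI allI impI)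
  fix a b p
  assume a: "a \<in> carrier R" and b: "b \<in> carrier R"
    and ab: "\<forall>q\<ge>p. \<forall>r\<in>carrier R. a \<otimes> (\<sigma> ^^ p) r \<otimes> (\<sigma> ^^ q) b \<in> I"
  \<comment> \<open>\<open>A\<close> collects all elements that can replace \<open>a\<close> in the
    hypothesis, and \<open>B\<close> all that can replace \<open>b\<close> against every element of
    \<open>A\<close>.\<close>
  define A where "A = {x \<in> carrier R. \<forall>q\<ge>p. \<forall>r\<in>carrier R. x \<otimes> (\<sigma> ^^ p) r \<otimes> (\<sigma> ^^ q) b \<in> I}"
  define B where
    "B = {y \<in> carrier R. \<forall>x\<in>A. \<forall>q\<ge>p. \<forall>r\<in>carrier R. x \<otimes> (\<sigma> ^^ p) r \<otimes> (\<sigma> ^^ q) y \<in> I}"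
  have A_carrier: "x \<in> carrier R" if "x \<in> A" for x using that by (simp add: A_def)
  have A: "left_ideal A R"
    using b by (intro left_idealI) (auto simp: A_def l_distr m_assoc I.I_l_closed)
  have B: "ideal B R"
  proof (intro left_ideal_imp_ideal left_idealI ring_axioms)
    fix r y assume r: "r \<in> carrier R" and y: "y \<in> B"
    then have yc: "y \<in> carrier R" by (simp add: B_def)
    have "x \<otimes> (\<sigma> ^^ p) s \<otimes> (\<sigma> ^^ q) (r \<otimes> y) \<in> I"
      if "x \<in> A" "q \<ge> p" "s \<in> carrier R" for x q s
    proof -
      \<comment> \<open>As \<open>q \<ge> p\<close>, the factor \<open>\<sigma>^q(r)\<close> equals
        \<open>\<sigma>^p(\<sigma>^(q-p)(r))\<close> and merges with
        \<open>\<sigma>^p(s)\<close>.\<close>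
      have "x \<otimes> (\<sigma> ^^ p) (s \<otimes> (\<sigma> ^^ (q - p)) r) \<otimes> (\<sigma> ^^ q) y \<in> I"
        using y that r unfolding B_def by blast
      then show ?thesis using that r yc A_carrier by (simp add: m_assoc)
    qed
    then show "r \<otimes> y \<in> B" using r yc by (simp add: B_def)
    have "x \<otimes> (\<sigma> ^^ p) s \<otimes> (\<sigma> ^^ q) (y \<otimes> r) \<in> I"
      if "x \<in> A" "q \<ge> p" "s \<in> carrier R" for x q s
    proof -
      have "x \<otimes> (\<sigma> ^^ p) s \<otimes> (\<sigma> ^^ q) y \<otimes> (\<sigma> ^^ q) r \<in> I"
        using y that r unfolding B_def by (blast intro: I.I_r_closed)
      then show ?thesis using that r yc A_carrier by (simp add: m_assoc)
    qed
    then show "y \<otimes> r \<in> B" using r yc by (simp add: B_def)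
  qed (use A_carrier in \<open>auto simp: B_def r_distr\<close>)
  have stable: "sigma_stable \<sigma> B"
    unfolding sigma_stable_def
  proof safe
    fix y assume y: "y \<in> B"
    have "x \<otimes> (\<sigma> ^^ p) s \<otimes> (\<sigma> ^^ q) (\<sigma> y) \<in> I"
      if "x \<in> A" "q \<ge> p" "s \<in> carrier R" for x q s
    proof -
      \<comment> \<open>Applying \<open>\<sigma>\<close> to \<open>y\<close> only raises
        \<open>q\<close>, and the range \<open>q \<ge> p\<close> is closed upwards.\<close>
      have "x \<otimes> (\<sigma> ^^ p) s \<otimes> (\<sigma> ^^ Suc q) y \<in> I"
        using y that unfolding B_def by (blast intro: le_SucI)
      then show ?thesis by (simp add: funpow_swap1)
    qed
    then show "\<sigma> y \<in> B" using y ring_hom_closed[OF sigma_hom] by (simp add: B_def)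
  qed
  have "A \<cdot> ((\<sigma> ^^ p) ` B) \<subseteq> I"
  proof -
    have "x \<otimes> (\<sigma> ^^ p) y \<in> I" if "x \<in> A" "y \<in> B" for x y
    proof -
      have "x \<otimes> (\<sigma> ^^ p) \<one> \<otimes> (\<sigma> ^^ p) y \<in> I" using that unfolding B_def by blast
      then show ?thesis using that A_carrier by simp
    qed
    then show ?thesis by (auto simp: ideal_prod_subset_iff I.is_additive_subgroup)
  qed
  with cond A B stable have "A \<subseteq> I \<or> B \<subseteq> I" unfolding left_ideal_cond_def by blast
  moreover have "a \<in> A" using a ab by (simp add: A_def)
  moreover have "b \<in> B" using b by (auto simp: B_def A_def)
  ultimately show "a \<in> I \<or> b \<in> I" by blast
qed

section \<open>The left ideal condition and the stable ideal condition\<close>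

lemma left_ideal_cond_imp_stable_ideal_cond:
  assumes cond: "left_ideal_cond R \<sigma> I"
  shows "stable_ideal_cond R \<sigma> I"
  unfolding stable_ideal_cond_def
proof (intro allI impI)
  fix A B assume AB: "ideal A R" "ideal B R" "sigma_stable \<sigma> B" "A \<cdot> B \<subseteq> I"
  then have "A \<cdot> ((\<sigma> ^^ 0) ` B) \<subseteq> I" by simp
  then show "A \<subseteq> I \<or> B \<subseteq> I"
    using cond AB ideal_imp_left_ideal unfolding left_ideal_cond_def by blast
qed

lemma sigma_invariant_pow:
  assumes "sigma_invariant R \<sigma> I" "a \<in> carrier R" "(\<sigma> ^^ n) a \<in> I"
  shows "a \<in> I"
  using assms(3)
proof (induct n)
  case (Suc n)
  then have "(\<sigma> ^^ n) a \<in> {r \<in> carrier R. \<sigma> r \<in> I}" using assms(2) by simp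
  then show ?case using assms(1) Suc.hyps unfolding sigma_invariant_def by simp
qed simp

lemma sigma_pow_surj:
  assumes "\<sigma> ` carrier R = carrier R"
  shows "(\<sigma> ^^ n) ` carrier R = carrier R"
  by (induct n) (auto simp only: funpow.simps image_comp[symmetric] image_id id_apply assms image_ident)

lemma stable_ideal_cond_imp_left_ideal_cond:
  assumes cond: "stable_ideal_cond R \<sigma> I" and inv: "sigma_invariant R \<sigma> I"
    and R: "cring R \<or> \<sigma> ` carrier R = carrier R"
  shows "left_ideal_cond R \<sigma> I"
  unfolding left_ideal_cond_def
proof (intro allI impI)
  fix A B
  assume A: "left_ideal A R" and B: "ideal B R" "sigma_stable \<sigma> B"
    and "\<exists>p. A \<cdot> ((\<sigma> ^^ p) ` B) \<subseteq> I"
  then obtain p where p: "\<And>a b. a \<in> A \<Longrightarrow> b \<in> B \<Longrightarrow> a \<otimes> (\<sigma> ^^ p) b \<in> I"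
    by (auto simp: ideal_prod_subset_iff I.is_additive_subgroup)
  interpret B: ideal B R by fact
  \<comment> \<open>\<open>A'\<close> is the left annihilator of \<open>\<sigma>^p(B)\<close> modulo
    \<open>I\<close> and contains \<open>A\<close>. Quantifying over all \<open>k\<close> makes
    \<open>B'\<close> stable, and \<open>B'\<close> will contain
    \<open>\<sigma>^p(B)\<close>.\<close>
  define A' where "A' = {x \<in> carrier R. \<forall>b\<in>B. x \<otimes> (\<sigma> ^^ p) b \<in> I}"
  define B' where "B' = {y \<in> carrier R. \<forall>x\<in>A'. \<forall>k. x \<otimes> (\<sigma> ^^ k) y \<in> I}"
  have A'_carrier: "x \<in> carrier R" if "x \<in> A'" for x using that by (simp add: A'_def)
  have A': "ideal A' R"
  proof (intro left_ideal_imp_ideal left_idealI ring_axioms)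
    fix r x assume r: "r \<in> carrier R" and x: "x \<in> A'"
    then show "r \<otimes> x \<in> A'" by (auto simp: A'_def m_assoc I.I_l_closed)
    have "x \<otimes> r \<otimes> (\<sigma> ^^ p) b \<in> I" if b: "b \<in> B" for b
      using R
    proof
      assume "cring R"
      then interpret cring R .
      have "x \<otimes> r \<otimes> (\<sigma> ^^ p) b = x \<otimes> (\<sigma> ^^ p) b \<otimes> r"
        using r A'_carrier[OF x] b by (simp add: m_ac)
      then show ?thesis using r x b by (simp add: A'_def I.I_r_closed)
    next
      assume "\<sigma> ` carrier R = carrier R"
      \<comment> \<open>Writing \<open>r\<close> as \<open>\<sigma>^p(s)\<close> moves it inside:
        \<open>r \<sigma>^p(b) = \<sigma>^p(s b)\<close> with \<open>s b\<close> in
        \<open>B\<close>.\<close>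
      then obtain s where s: "s \<in> carrier R" "r = (\<sigma> ^^ p) s"
        using r sigma_pow_surj[of p] by blast
      have "x \<otimes> (\<sigma> ^^ p) (s \<otimes> b) \<in> I" using x b s by (simp add: A'_def B.I_l_closed del: sigma_pow_mult)
      then show ?thesis using s b A'_carrier[OF x] by (simp add: m_assoc)
    qed
    then show "x \<otimes> r \<in> A'" using r x by (simp add: A'_def)
  qed (auto simp: A'_def l_distr)
  have B': "ideal B' R"
  proof (intro left_ideal_imp_ideal left_idealI ring_axioms)
    fix r y assume r: "r \<in> carrier R" and y: "y \<in> B'"
    then have yc: "y \<in> carrier R" by (simp add: B'_def)
    have "x \<otimes> (\<sigma> ^^ k) (r \<otimes> y) \<in> I" if x: "x \<in> A'" for x k
    proof -
      \<comment> \<open>The right ideal property of \<open>A'\<close> is used here: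
        \<open>x \<sigma>^k(r)\<close> stays in \<open>A'\<close>.\<close>
      have "(x \<otimes> (\<sigma> ^^ k) r) \<otimes> (\<sigma> ^^ k) y \<in> I"
        using ideal.I_r_closed[OF A' x, of "(\<sigma> ^^ k) r"] r y by (simp add: B'_def)
      then show ?thesis using r yc A'_carrier[OF x] by (simp add: m_assoc)
    qed
    then show "r \<otimes> y \<in> B'" using r yc by (simp add: B'_def)
    have "x \<otimes> (\<sigma> ^^ k) (y \<otimes> r) \<in> I" if x: "x \<in> A'" for x k
    proof -
      have "(x \<otimes> (\<sigma> ^^ k) y) \<otimes> (\<sigma> ^^ k) r \<in> I"
        using x r y by (simp add: B'_def I.I_r_closed)
      then show ?thesis using r yc A'_carrier[OF x] by (simp add: m_assoc)
    qed
    then show "y \<otimes> r \<in> B'" using r yc by (simp add: B'_def)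
  qed (use A'_carrier in \<open>auto simp: B'_def r_distr\<close>)
  have stable: "sigma_stable \<sigma> B'"
    unfolding sigma_stable_def
  proof safe
    fix y assume y: "y \<in> B'"
    have "x \<otimes> (\<sigma> ^^ k) (\<sigma> y) \<in> I" if "x \<in> A'" for x k
    proof -
      have "x \<otimes> (\<sigma> ^^ Suc k) y \<in> I" using y that unfolding B'_def by blast
      then show ?thesis by (simp add: funpow_swap1)
    qed
    then show "\<sigma> y \<in> B'" using y ring_hom_closed[OF sigma_hom] by (simp add: B'_def)
  qed
  have "x \<otimes> y \<in> I" if "x \<in> A'" "y \<in> B'" for x y
  proof -
    have "x \<otimes> (\<sigma> ^^ 0) y \<in> I" using that unfolding B'_def by blast
    then show ?thesis by simp
  qed
  then have "A' \<cdot> B' \<subseteq> I" by (auto simp: ideal_prod_subset_iff I.is_additive_subgroup)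
  with cond A' B' stable have "A' \<subseteq> I \<or> B' \<subseteq> I" unfolding stable_ideal_cond_def by blast
  moreover have "A \<subseteq> A'"
    using A p by (auto simp: A'_def left_ideal_def dest: additive_subgroup.a_subset)
  moreover have "(\<sigma> ^^ p) b \<in> B'" if b: "b \<in> B" for b
  proof -
    have "x \<otimes> (\<sigma> ^^ k) ((\<sigma> ^^ p) b) \<in> I" if "x \<in> A'" for x k
    proof -
      \<comment> \<open>Powers of \<open>\<sigma>\<close> commute, and \<open>\<sigma>^k(b)\<close>
        lies in \<open>B\<close> by stability.\<close>
      have "x \<otimes> (\<sigma> ^^ p) ((\<sigma> ^^ k) b) \<in> I"
        using that sigma_pow_stable[OF B(2) b] unfolding A'_def by blast
      then show ?thesis by (simp add: add.commute)
    qed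
    then show ?thesis using b by (simp add: B'_def)
  qed
  ultimately show "A \<subseteq> I \<or> B \<subseteq> I"
    using sigma_invariant_pow[OF inv, of _ p] B.Icarr by blast
qed

end

end

text \<open>The equivalence of (1) and (2) is stated for proper \<open>I\<close>: prime ideals are
  proper by definition, whereas \<open>elementwise_cond\<close> holds trivially when
  \<open>I\<close> is all of \<open>R\<close>.\<close>

theorem proposition5p2:
  fixes R :: "('a, 'm) ring_scheme" and \<sigma> :: "'a \<Rightarrow> 'a" and I :: "'a set"
  assumes "ring R"
    and "\<sigma> \<in> ring_hom R R"
    and "ideal I R"
    and "sigma_stable \<sigma> I"
  shows "skew_poly_over R I = skew_extension R \<sigma> I
    \<and> (I \<noteq> carrier R \<longrightarrow> (right_S_prime R \<sigma> I \<longleftrightarrow> elementwise_cond R \<sigma> I))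
    \<and> (elementwise_cond R \<sigma> I \<longleftrightarrow> left_ideal_cond R \<sigma> I)
    \<and> (sigma_invariant R \<sigma> I \<and> (cring R \<or> \<sigma> ` carrier R = carrier R)
         \<longrightarrow> (left_ideal_cond R \<sigma> I \<longleftrightarrow> stable_ideal_cond R \<sigma> I))"
proof -
  interpret skew_ring R \<sigma>
    by (intro skew_ring.intro skew_ring_axioms.intro assms(1,2))
  note I = assms(3,4)
  show ?thesis
    using skew_poly_over_eq_extension[OF I] right_S_prime_imp_elementwise[OF I]
      elementwise_imp_right_S_prime[OF I] elementwise_imp_left_ideal_cond[OF I]
      left_ideal_cond_imp_elementwise[OF I] left_ideal_cond_imp_stable_ideal_cond[OF I]
      stable_ideal_cond_imp_left_ideal_cond[OF I]
    by blast
qed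

end
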